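(* Let $\mathrm{S}$ be a semi-alternative algebra over $\mathbb{C}$. Then $(\mathrm{S},[\cdot,\cdot])$, where $[x,y]=\frac12(xy-yx)$, is a Malcev algebra. If $\mathrm{S}$ is anticommutative, then $\mathrm{S}$ is $3$-step nilpotent. If $\mathrm{S}$ is commutative, then $\mathrm{S}$ is associative.
   Context: Write $(x,y,z)=(xy)z-x(yz)$. An algebra is semi-alternative if $(x,y,z)=(y,z,x)$ for all $x,y,z$. A Malcev algebra is an anticommutative algebra with product $[\cdot,\cdot]$ satisfying $J([x,z],y,x)=[x,J(x,y,z)]$ for all $x,y,z$, where $J(a,b,c)=[[a,b],c]+[[b,c],a]+[[c,a],b]$. Anticommutative means $xy=-yx$ for all $x,y$. $3$-step nilpotent means that every product of four elements, with any arrangement of parentheses, is zero. *)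

theory Defs
  imports Complex_Main
begin

text \<open>A (not necessarily associative, unital or finite-dimensional) algebra over the complex
  numbers: a complex vector space with a bilinear product.\<close>

locale complex_algebra = vector_space scale
  for scale :: "complex \<Rightarrow> 'a::ab_group_add \<Rightarrow> 'a" +
  fixes mul :: "'a \<Rightarrow> 'a \<Rightarrow> 'a"
  assumes linear_mul_left: "Vector_Spaces.linear scale scale (\<lambda>x. mul x y)"
    and linear_mul_right: "Vector_Spaces.linear scale scale (\<lambda>y. mul x y)"

definition associator :: "('a::ab_group_add \<Rightarrow> 'a \<Rightarrow> 'a) \<Rightarrow> 'a \<Rightarrow> 'a \<Rightarrow> 'a \<Rightarrow> 'a" where
  "associator mul x y z = mul (mul x y) z - mul x (mul y z)"

locale semi_alternative_algebra = complex_algebra +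
  assumes associator_cyclic: "associator mul x y z = associator mul y z x"

definition anticommutative_product :: "('a::ab_group_add \<Rightarrow> 'a \<Rightarrow> 'a) \<Rightarrow> bool" where
  "anticommutative_product mul \<longleftrightarrow> (\<forall>x y. mul x y = - mul y x)"

definition commutative_product :: "('a \<Rightarrow> 'a \<Rightarrow> 'a) \<Rightarrow> bool" where
  "commutative_product mul \<longleftrightarrow> (\<forall>x y. mul x y = mul y x)"

definition associative_product :: "('a \<Rightarrow> 'a \<Rightarrow> 'a) \<Rightarrow> bool" where
  "associative_product mul \<longleftrightarrow> (\<forall>x y z. mul (mul x y) z = mul x (mul y z))"

definition jacobian :: "('a::ab_group_add \<Rightarrow> 'a \<Rightarrow> 'a) \<Rightarrow> 'a \<Rightarrow> 'a \<Rightarrow> 'a \<Rightarrow> 'a" where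
  "jacobian br a b c = br (br a b) c + br (br b c) a + br (br c a) b"

locale malcev_algebra = complex_algebra scale br
  for scale :: "complex \<Rightarrow> 'a::ab_group_add \<Rightarrow> 'a" and br :: "'a \<Rightarrow> 'a \<Rightarrow> 'a" +
  assumes anticommutative: "anticommutative_product br"
    and malcev_identity: "jacobian br (br x z) y x = br x (jacobian br x y z)"

definition half_commutator ::
  "(complex \<Rightarrow> 'a::ab_group_add \<Rightarrow> 'a) \<Rightarrow> ('a \<Rightarrow> 'a \<Rightarrow> 'a) \<Rightarrow> 'a \<Rightarrow> 'a \<Rightarrow> 'a" where
  "half_commutator scale mul x y = scale (1 / 2) (mul x y - mul y x)"

text \<open>\<open>is_product mul n a\<close>: the element \<open>a\<close> is a product of \<open>n\<close> elements, with some arrangement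
  of parentheses.\<close>

inductive is_product :: "('a \<Rightarrow> 'a \<Rightarrow> 'a) \<Rightarrow> nat \<Rightarrow> 'a \<Rightarrow> bool"
  for mul :: "'a \<Rightarrow> 'a \<Rightarrow> 'a" where
  single: "is_product mul 1 x"
| mul: "is_product mul m x \<Longrightarrow> is_product mul n y \<Longrightarrow> is_product mul (m + n) (mul x y)"

text \<open>The step is an upper bound; smaller nilpotency steps are not excluded.\<close>

definition step_nilpotent :: "nat \<Rightarrow> ('a::zero \<Rightarrow> 'a \<Rightarrow> 'a) \<Rightarrow> bool" where
  "step_nilpotent k mul \<longleftrightarrow> (\<forall>a. is_product mul (k + 1) a \<longrightarrow> a = 0)"

end

theory Submission
  imports Defs
begin

text \<open>
  In degree four, the Teichmueller identity writes
  \<open>(wx,y,z) - (w,xy,z) + (w,x,yz)\<close> as \<open>w(x,y,z) + (w,x,y)z\<close>. When the associator is cyclic, the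
  left-hand sides for the four cyclic shifts of \<open>w,x,y,z\<close> involve only the four elements
  \<open>(wx,y,z)\<close>, \<open>(xy,z,w)\<close>, \<open>(yz,w,x)\<close>, \<open>(zw,x,y)\<close>, and the resulting linear system is invertible;
  so \<open>3(wx,y,z)\<close> is a combination of products of elements with associators. Substituting this in
  the Malcev identity, where the Jacobian of the commutator is \<open>3((x,y,z) - (y,x,z))\<close>, gives the
  first claim.

  In the anticommutative case \<open>(xy)z\<close> is alternating, hence so is \<open>g(x,y,z,w) = ((xy)z)w\<close>; then
  \<open>(xy)(zw)\<close> equals both \<open>g(z,w,x,y) = g(x,y,z,w)\<close> and \<open>- g(x,y,z,w)\<close>. In the commutative case
  the three cyclic shifts of an associator add up to zero.
\<close>

section \<open>Scalars 2 and 3, bilinearity, and identities valid in every complex algebra\<close>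

context vector_space
begin

lemma scale_two: "scale 2 a = a + a"
  using scale_left_distrib[of 1 1 a] by simp

lemma scale_three: "scale 3 a = a + a + a"
  using scale_left_distrib[of 2 1 a] by (simp add: scale_two)

end

context complex_algebra
begin

lemma double_eq_0: "a + a = 0 \<Longrightarrow> a = 0" for a :: 'a
  using scale_eq_0_iff[of 2 a] by (simp add: scale_two)

lemma triple_eq_0: "a + a + a = 0 \<Longrightarrow> a = 0" for a :: 'a
  using scale_eq_0_iff[of 3 a] by (simp add: scale_three)

abbreviation assoc where "assoc \<equiv> associator mul"

definition commutator where "commutator x y = mul x y - mul y x"

lemmas hom_left = linear_mul_left[folded module_hom_iff_linear]
lemmas hom_right = linear_mul_right[folded module_hom_iff_linear]

lemma mul_add_left: "mul (x + x') y = mul x y + mul x' y"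
  and mul_diff_left: "mul (x - x') y = mul x y - mul x' y"
  and mul_minus_left: "mul (- x) y = - mul x y"
  and mul_zero_left: "mul 0 y = 0"
  and mul_scale_left: "mul (scale c x) y = scale c (mul x y)"
  using module_hom.add[OF hom_left] module_hom.diff[OF hom_left] module_hom.neg[OF hom_left]
    module_hom.zero[OF hom_left] module_hom.scale[OF hom_left] by this+

lemma mul_add_right: "mul x (y + y') = mul x y + mul x y'"
  and mul_diff_right: "mul x (y - y') = mul x y - mul x y'"
  and mul_minus_right: "mul x (- y) = - mul x y"
  and mul_zero_right: "mul x 0 = 0"
  and mul_scale_right: "mul x (scale c y) = scale c (mul x y)"
  using module_hom.add[OF hom_right] module_hom.diff[OF hom_right] module_hom.neg[OF hom_right]
    module_hom.zero[OF hom_right] module_hom.scale[OF hom_right] by this+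

lemmas mul_linear =
  mul_add_left mul_diff_left mul_minus_left mul_zero_left mul_scale_left
  mul_add_right mul_diff_right mul_minus_right mul_zero_right mul_scale_right

lemma teichmuller:
  "assoc (mul w x) y z - assoc w (mul x y) z + assoc w x (mul y z)
    = mul w (assoc x y z) + mul (assoc w x y) z"
  by (simp add: associator_def mul_linear algebra_simps)

text \<open>The twelve monomials of the Jacobian are exactly those of the six associators, signed by
  the permutation.\<close>

lemma jacobian_commutator:
  "jacobian commutator x y z =
    (assoc x y z + assoc y z x + assoc z x y) - (assoc y x z + assoc x z y + assoc z y x)"
  by (simp add: jacobian_def commutator_def associator_def mul_linear algebra_simps)

lemma half_commutator_eq: "half_commutator scale mul x y = scale (1 / 2) (commutator x y)"
  by (simp add: half_commutator_def commutator_def)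

lemma commutator_scale_left: "commutator (scale c x) y = scale c (commutator x y)"
  and commutator_scale_right: "commutator x (scale c y) = scale c (commutator x y)"
  by (simp_all add: commutator_def mul_linear scale_right_diff_distrib)

lemma complex_algebra_half_commutator: "complex_algebra scale (half_commutator scale mul)"
proof (intro complex_algebra.intro complex_algebra_axioms.intro vector_space_axioms)
  show "Vector_Spaces.linear scale scale (\<lambda>x. half_commutator scale mul x y)" for y
    by unfold_locales
      (simp_all add: half_commutator_def mul_linear algebra_simps)
  show "Vector_Spaces.linear scale scale (\<lambda>y. half_commutator scale mul x y)" for x
    by unfold_locales
      (simp_all add: half_commutator_def mul_linear algebra_simps)
qed

lemma jacobian_half_commutator:
  "jacobian (half_commutator scale mul) x y z = scale (1 / 4) (jacobian commutator x y z)"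
  by (simp add: jacobian_def half_commutator_eq commutator_scale_left scale_right_distrib)

end

section \<open>The Malcev identity from the cyclic associator\<close>

context semi_alternative_algebra
begin

text \<open>The system is circulant with first row \<open>(1, -1, 1, 0)\<close>; the coefficients
  \<open>1, 2, 1, -1\<close> form the first row of three times its inverse.\<close>

lemma cyclic_solution:
  fixes w x y z
  defines "R \<equiv> \<lambda>w x y z. mul w (assoc x y z) + mul (assoc w x y) z"
  shows "scale 3 (assoc (mul w x) y z) =
    R w x y z + scale 2 (R x y z w) + R y z w x - R z w x y"
proof -
  \<comment> \<open>Rotating once or twice brings the inner product of each associator to the first
    slot.\<close>
  have R: "R a b c d = assoc (mul a b) c d - assoc (mul b c) d a + assoc (mul c d) a b"
    for a b c d
    using teichmuller[of a b c d] associator_cyclic[of a "mul b c" d]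
      associator_cyclic[of a b "mul c d"] associator_cyclic[of b "mul c d" a]
    by (simp add: R_def)
  show ?thesis
    unfolding R by (simp add: scale_three scale_two)
qed

lemma jacobian_commutator_eq:
  "jacobian commutator x y z = scale 3 (assoc x y z - assoc y x z)"
proof -
  have "assoc y z x = assoc x y z" "assoc z x y = assoc x y z"
    "assoc x z y = assoc y x z" "assoc z y x = assoc y x z"
    using associator_cyclic by metis+
  then show ?thesis
    unfolding jacobian_commutator by (simp add: scale_three)
qed

text \<open>By \<open>jacobian_commutator_eq\<close> this is the Malcev identity for
  \<open>commutator\<close>, up to the factor 3.\<close>

lemma associator_commutator_swap:
  "assoc (commutator x z) y x - assoc y (commutator x z) x
    = commutator x (assoc x y z - assoc y x z)"
proof -
  \<comment> \<open>One representative per cyclic class, so that equal associators cancel after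
    rewriting.\<close>
  have cyc: "assoc y z x = assoc x y z" "assoc z x y = assoc x y z"
    "assoc x z y = assoc y x z" "assoc z y x = assoc y x z"
    "assoc x y x = assoc x x y" "assoc y x x = assoc x x y"
    "assoc x z x = assoc x x z" "assoc z x x = assoc x x z"
    using associator_cyclic by metis+
  \<comment> \<open>The left-hand side becomes \<open>(P - Q) - (S - T)\<close> once its second
    associator is rotated; all four then have the shape treated by
    \<open>cyclic_solution\<close>.\<close>
  define P where "P = assoc (mul x z) y x"
  define Q where "Q = assoc (mul z x) y x"
  define S where "S = assoc (mul x z) x y"
  define T where "T = assoc (mul z x) x y"
  have "scale 3 (P - Q - S + T) = scale 3 P - scale 3 Q - scale 3 S + scale 3 T"
    by (simp add: scale_right_diff_distrib scale_right_distrib)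
  also have "\<dots> = scale 3 (commutator x (assoc x y z - assoc y x z))"
    unfolding P_def Q_def S_def T_def cyclic_solution cyc
    by (simp add: scale_two scale_three commutator_def mul_linear)
  finally have "P - Q - S + T = commutator x (assoc x y z - assoc y x z)"
    by simp
  moreover have "assoc (commutator x z) y x = P - Q"
    by (simp add: P_def Q_def associator_def commutator_def mul_linear)
  moreover have "assoc y (commutator x z) x = assoc (commutator x z) x y"
    by (rule associator_cyclic)
  moreover have "assoc (commutator x z) x y = S - T"
    by (simp add: S_def T_def associator_def commutator_def mul_linear)
  ultimately show ?thesis
    by (metis diff_diff_eq2 diff_add_eq)
qed

lemma malcev_half_commutator: "malcev_algebra scale (half_commutator scale mul)"
proof (intro malcev_algebra.intro malcev_algebra_axioms.intro complex_algebra_half_commutator)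
  show "anticommutative_product (half_commutator scale mul)"
    by (simp add: anticommutative_product_def half_commutator_def flip: scale_minus_right)
next
  fix x y z
  have "jacobian commutator (commutator x z) y x = commutator x (jacobian commutator x y z)"
    by (simp add: jacobian_commutator_eq commutator_scale_right associator_commutator_swap)
  \<comment> \<open>Both sides are cubic in the bracket, so halving it multiplies each by
    1/8.\<close>
  moreover have "jacobian commutator (scale c a) y x = scale c (jacobian commutator a y x)" for a c
    by (simp add: jacobian_def commutator_scale_left commutator_scale_right scale_right_distrib)
  ultimately show "jacobian (half_commutator scale mul) (half_commutator scale mul x z) y x
      = half_commutator scale mul x (jacobian (half_commutator scale mul) x y z)"
    by (simp add: jacobian_half_commutator half_commutator_eq commutator_scale_right)
qed

section \<open>The commutative case\<close>

lemma commutative_imp_associative: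
  assumes "commutative_product mul"
  shows "associative_product mul"
proof -
  have comm: "mul a b = mul b a" for a b
    using assms unfolding commutative_product_def by blast
  have "assoc x y z = 0" for x y z
  proof (rule triple_eq_0)
    have "assoc x y z + assoc y z x + assoc z x y = 0"
      using comm[of x "mul y z"] comm[of y "mul z x"] comm[of z "mul x y"]
      by (simp add: associator_def)
    then show "assoc x y z + assoc x y z + assoc x y z = 0"
      using associator_cyclic by metis
  qed
  then show ?thesis
    by (simp add: associative_product_def associator_def)
qed

section \<open>The anticommutative case\<close>

lemma anticommutative_products_of_four:
  assumes "anticommutative_product mul"
  shows "mul (mul (mul x y) z) w = 0" and "mul (mul x y) (mul z w) = 0"
proof -
  have anti: "mul a b = - mul b a" for a b
    using assms unfolding anticommutative_product_def by blast
  \<comment> \<open>Anticommutativity turns the associator into \<open>(ab)c + (bc)a\<close>;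
    equating it with its shift \<open>(bc)a + (ca)b\<close> cancels \<open>(bc)a\<close>.\<close>
  have cyc: "mul (mul a b) c = mul (mul c a) b" for a b c
    using associator_cyclic[of a b c] anti[of a "mul b c"] anti[of b "mul c a"]
    by (simp add: associator_def)
  have swap12: "mul (mul a b) c = - mul (mul b a) c" for a b c
    using anti[of a b] by (simp add: mul_linear)
  have swap23: "mul (mul a b) c = - mul (mul a c) b" for a b c
    using cyc swap12 by metis
  define g where "g a b c d = mul (mul (mul a b) c) d" for a b c d
  have g12: "g a b c d = - g b a c d" and g23: "g a b c d = - g a c b d"
    and g34: "g a b c d = - g a b d c" for a b c d
    unfolding g_def using swap12[of a b c] swap23[of a b c] swap23[of "mul a b" c d]
    by (simp_all add: mul_linear)
  \<comment> \<open>Four adjacent transpositions, hence sign +1.\<close>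
  have even: "g z w x y = g x y z w"
    using g23[of z w x y] g12[of z x w y] g34[of x z w y] g23[of x z y w] by simp
  have pair: "mul (mul x y) (mul z w) = g z w x y"
    unfolding g_def by (rule cyc[of x y "mul z w", THEN trans]) simp
  have "mul (mul x y) (mul z w) = - g x y z w"
    unfolding g_def using anti[of "mul x y" "mul z w"] cyc[of z w "mul x y"] by simp
  with pair even have "g x y z w + g x y z w = 0"
    by (metis add.left_inverse)
  then have "g x y z w = 0"
    by (rule double_eq_0)
  with pair even show "mul (mul (mul x y) z) w = 0" "mul (mul x y) (mul z w) = 0"
    by (simp_all add: g_def)
qed

end

section \<open>Products with arbitrary bracketing\<close>

lemma is_product_pos: "is_product mul n a \<Longrightarrow> 0 < n"
  by (induction rule: is_product.induct) auto

text \<open>Positivity of both lengths makes the two factors strictly shorter products.\<close>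

lemma is_product_split:
  assumes "is_product mul n a" and "1 < n"
  obtains k l x y where "a = mul x y" "n = k + l" "is_product mul k x" "is_product mul l y"
    "0 < k" "0 < l"
  using assms is_product_pos by (cases rule: is_product.cases) fast+

lemma is_product_2:
  assumes "is_product mul 2 a"
  obtains x y where "a = mul x y"
  using assms by (rule is_product_split) auto

lemma is_product_3:
  assumes "is_product mul 3 a"
  obtains x y z where "a = mul (mul x y) z" | x y z where "a = mul x (mul y z)"
proof -
  from assms obtain k l x y where *: "a = mul x y" "3 = k + l" "is_product mul k x"
    "is_product mul l y" "0 < k" "0 < l"
    by (rule is_product_split) auto
  then consider "k = 2" | "l = 2"
    by linarith
  then show thesis
  proof cases
    case 1
    with * obtain u v where "x = mul u v"
      by (auto elim: is_product_2)
    with * that(1) show thesis by simp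
  next
    case 2
    with * obtain u v where "y = mul u v"
      by (auto elim: is_product_2)
    with * that(2) show thesis by simp
  qed
qed

text \<open>The five bracketings of four elements split as 3+1, 1+3 or 2+2; anticommutativity
  reduces the first two kinds to \<open>((xy)z)w\<close> up to sign.\<close>

lemma (in semi_alternative_algebra) anticommutative_imp_step_nilpotent:
  assumes "anticommutative_product mul"
  shows "step_nilpotent 3 mul"
  unfolding step_nilpotent_def
proof (intro allI impI)
  have anti: "mul a b = - mul b a" for a b
    using assms unfolding anticommutative_product_def by blast
  have left: "mul b w = 0" if "is_product mul 3 b" for b w
    using that
  proof (cases rule: is_product_3)
    case (1 x y z)
    then show ?thesis
      by (simp add: anticommutative_products_of_four[OF assms])
  next
    case (2 x y z)
    then have "b = - mul (mul y z) x"
      using anti[of x "mul y z"] by simp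
    then show ?thesis
      by (simp add: mul_linear anticommutative_products_of_four[OF assms])
  qed
  fix a
  assume "is_product mul (3 + 1) a"
  then obtain k l x y where a: "a = mul x y" "3 + 1 = k + l" "is_product mul k x"
    "is_product mul l y" "0 < k" "0 < l"
    by (rule is_product_split) auto
  then consider "k = 3" | "l = 3" | "k = 2" "l = 2"
    by linarith
  then show "a = 0"
  proof cases
    case 1
    with a left show ?thesis by simp
  next
    case 2
    with a left anti[of x y] show ?thesis by simp
  next
    case 3
    with a obtain p q u v where "x = mul p q" "y = mul u v"
      by (auto elim!: is_product_2)
    with a show ?thesis
      by (simp add: anticommutative_products_of_four(2)[OF assms])
  qed
qed

theorem lemma25:
  fixes scale :: "complex \<Rightarrow> 'a::ab_group_add \<Rightarrow> 'a"
    and mul :: "'a \<Rightarrow> 'a \<Rightarrow> 'a"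
  assumes "semi_alternative_algebra scale mul"
  shows "malcev_algebra scale (half_commutator scale mul)
    \<and> (anticommutative_product mul \<longrightarrow> step_nilpotent 3 mul)
    \<and> (commutative_product mul \<longrightarrow> associative_product mul)"
proof -
  interpret semi_alternative_algebra scale mul
    by (fact assms)
  show ?thesis
    using malcev_half_commutator anticommutative_imp_step_nilpotent commutative_imp_associative
    by blast
qed

end
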